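(* Let $n\ge1$ and let $A\in M_n(\mathbb{C})$ have columns $c_1,\dots,c_n$. Then $$\|D_\phi(A)\|_2\le\sqrt{n!}\,\prod_{j=1}^n\|c_j\|_2.$$
   Context: Let $\omega=e^{2\pi i/n}$, let $S_n$ be the symmetric group on $\{1,\dots,n\}$ with composition $(\sigma\circ\tau)(i)=\sigma(\tau(i))$, let $\varepsilon(\sigma)$ be the sign of $\sigma$, and let $\rho=(1\,2\,\cdots\,n)$ be the cycle $\rho(i)=i+1$ for $i<n$, $\rho(n)=1$. Each orbit $\{\sigma\circ\rho^r: r\in\mathbb{Z}/n\mathbb{Z}\}$ contains exactly one permutation $\sigma^*$ with $\sigma^*(1)=1$. The orbital phase $\phi:S_n\to\mathbb{Z}/n\mathbb{Z}$ is the unique function such that $\phi(\sigma^*\circ\rho^r)=r$ for every $\sigma^*\in S_n$ with $\sigma^*(1)=1$ and every $r$. For $A=(a_{ij})\in M_n(\mathbb{C})$ put $m_\sigma(A)=\varepsilon(\sigma)\prod_{i=1}^n a_{i,\sigma(i)}$, $\Lambda_r(A)=\sum_{\sigma:\phi(\sigma)=r}m_\sigma(A)$ for $r=0,\dots,n-1$, $G_k(A)=\sum_{r=0}^{n-1}\Lambda_r(A)\omega^{kr}$, and $D_\phi(A)=(G_0(A),\dots,G_{n-1}(A))\in\mathbb{C}^n$. $\|\cdot\|_2$ is the Euclidean norm on $\mathbb{C}^n$. *)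

theory Defs
  imports
    "HOL-Analysis.L2_Norm"
    "HOL-Combinatorics.Permutations"
    "Jordan_Normal_Form.Matrix"
begin

(* Elements of S_n are the functions \<sigma> with "\<sigma> permutes {1..n}"; elements of Z/nZ are
   represented by their residues 0, ..., n - 1. *)

definition cyc :: "nat \<Rightarrow> nat \<Rightarrow> nat" where
  "cyc n i = (if 1 \<le> i \<and> i < n then i + 1 else if i = n then 1 else i)"

(* For n >= 1 and \<sigma> in S_n the description below determines r uniquely
   (see orbital_phase_ex1), and the resulting function has the defining property of the
   orbital phase (see orbital_phase_comp_cyc). *)
definition orbital_phase :: "nat \<Rightarrow> (nat \<Rightarrow> nat) \<Rightarrow> nat" where
  "orbital_phase n \<sigma> =
     (THE r. r < n \<and> (\<exists>\<tau>. \<tau> permutes {1..n} \<and> \<tau> 1 = 1 \<and> \<sigma> = \<tau> \<circ> (cyc n ^^ r)))"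

(* Matrix indices of the library start at 0, whereas permutations act on {1..n}:
   the entry a_{ij} is A $$ (i - 1, j - 1). *)
definition perm_monomial :: "nat \<Rightarrow> complex mat \<Rightarrow> (nat \<Rightarrow> nat) \<Rightarrow> complex" where
  "perm_monomial n A \<sigma> = of_int (sign \<sigma>) * (\<Prod>i = 1..n. A $$ (i - 1, \<sigma> i - 1))"

definition phase_sum :: "nat \<Rightarrow> complex mat \<Rightarrow> nat \<Rightarrow> complex" where
  "phase_sum n A r =
     (\<Sum>\<sigma> | \<sigma> permutes {1..n} \<and> orbital_phase n \<sigma> = r. perm_monomial n A \<sigma>)"

definition root_unity :: "nat \<Rightarrow> complex" where
  "root_unity n = exp (2 * of_real pi * \<i> / of_nat n)"

definition phase_transform :: "nat \<Rightarrow> complex mat \<Rightarrow> nat \<Rightarrow> complex" where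
  "phase_transform n A k = (\<Sum>r = 0..<n. phase_sum n A r * root_unity n ^ (k * r))"

definition D_phase :: "nat \<Rightarrow> complex mat \<Rightarrow> complex vec" where
  "D_phase n A = vec n (phase_transform n A)"

definition vec_l2_norm :: "complex vec \<Rightarrow> real" where
  "vec_l2_norm v = L2_set (\<lambda>i. cmod (v $ i)) {0..<dim_vec v}"

lemma cyc_permutes:
  assumes "n \<ge> 1"
  shows "cyc n permutes {1..n}"
proof -
  have "bij_betw (cyc n) {1..n} {1..n}"
  proof (rule bij_betwI)
    show "cyc n \<in> {1..n} \<rightarrow> {1..n}" using assms by (auto simp: cyc_def)
    show "(\<lambda>i. if i = 1 then n else i - 1) \<in> {1..n} \<rightarrow> {1..n}" using assms by auto
  qed (auto simp: cyc_def)
  thus ?thesis using assms by (intro bij_imp_permutes) (auto simp: cyc_def)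
qed

lemma cyc_funpow:
  assumes "1 \<le> i" "i \<le> n"
  shows "(cyc n ^^ r) i = (i - 1 + r) mod n + 1"
proof (induction r)
  case 0
  show ?case using assms by simp
next
  case (Suc r)
  define j where "j = (i - 1 + r) mod n"
  have "j < n" using assms by (simp add: j_def)
  moreover have "(i - 1 + Suc r) mod n = (if Suc j = n then 0 else Suc j)"
    by (simp add: j_def mod_Suc)
  moreover have "(cyc n ^^ Suc r) i = cyc n (j + 1)" using Suc by (simp add: j_def)
  moreover have "cyc n (j + 1) = (if Suc j = n then 1 else j + 2)" if "j < n"
    using that by (simp add: cyc_def)
  ultimately show ?case by simp
qed

lemma cyc_funpow_permutes:
  assumes "n \<ge> 1"
  shows "(cyc n ^^ r) permutes {1..n}"
proof (induction r)
  case 0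
  show ?case using permutes_id[of "{1..n}"] by (simp add: id_def)
next
  case (Suc r)
  thus ?case using permutes_compose[OF Suc cyc_permutes[OF assms]] by (simp add: o_def)
qed

lemma cyc_funpow_mod:
  assumes "n \<ge> 1"
  shows "cyc n ^^ (r mod n) = cyc n ^^ r"
proof
  fix i
  show "(cyc n ^^ (r mod n)) i = (cyc n ^^ r) i"
  proof (cases "i \<in> {1..n}")
    case True
    thus ?thesis using mod_add_right_eq[of "i - 1" r n] by (simp only: cyc_funpow atLeastAtMost_iff)
  next
    case False
    thus ?thesis using cyc_funpow_permutes[OF assms] permutes_not_in by metis
  qed
qed

lemma phase_unique:
  assumes n: "n \<ge> 1" and r: "r < n" and s: "s < n"
    and "\<tau> permutes {1..n}" "\<tau> 1 = 1" "\<tau>' permutes {1..n}" "\<tau>' 1 = 1"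
    and eq: "\<tau> \<circ> (cyc n ^^ r) = \<tau>' \<circ> (cyc n ^^ s)"
  shows "r = s"
proof -
  define i where "i = (n - r) mod n + 1"
  have i: "1 \<le> i" "i \<le> n" using n by (auto simp: i_def Suc_le_eq)
  have "(i - 1 + r) mod n = (n - r + r) mod n" unfolding i_def by (simp add: mod_add_left_eq)
  hence "(cyc n ^^ r) i = 1" using i r by (simp add: cyc_funpow)
  hence "\<tau>' ((cyc n ^^ s) i) = 1" using eq assms(5) by (metis comp_apply)
  hence "(cyc n ^^ s) i = 1" using assms(6,7) by (metis permutes_inj injD)
  hence "(i - 1 + s) mod n = 0" using i by (simp add: cyc_funpow)
  hence "((n - r) mod n + s) mod n = 0" by (simp add: i_def)
  hence "(n - r + s) mod n = 0" by (simp add: mod_add_left_eq)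
  then obtain q where q: "n - r + s = n * q" by auto
  have "0 < n * q" "n * q < n * 2" using q r s by linarith+
  hence "0 < q" "q < 2" by (metis nat_0_less_mult_iff, metis mult_less_cancel1)
  hence "q = 1" by simp
  thus ?thesis using q r by auto
qed

lemma orbital_phase_ex1:
  assumes n: "n \<ge> 1" and \<sigma>: "\<sigma> permutes {1..n}"
  shows "\<exists>!r. r < n \<and> (\<exists>\<tau>. \<tau> permutes {1..n} \<and> \<tau> 1 = 1 \<and> \<sigma> = \<tau> \<circ> (cyc n ^^ r))"
proof (rule ex_ex1I)
  obtain i where i: "i \<in> {1..n}" "\<sigma> i = 1"
    using permutes_image[OF \<sigma>] n by (metis atLeastAtMost_iff imageE le_refl)
  define \<tau> where "\<tau> = \<sigma> \<circ> (cyc n ^^ (i - 1))"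
  define r where "r = (n - (i - 1)) mod n"
  have "(cyc n ^^ (i - 1)) 1 = i" using i n by (auto simp: cyc_funpow)
  hence "\<tau> 1 = 1" using i by (simp add: \<tau>_def)
  moreover have "\<tau> permutes {1..n}"
    unfolding \<tau>_def by (intro permutes_compose[OF cyc_funpow_permutes[OF n] \<sigma>])
  moreover have "\<tau> \<circ> (cyc n ^^ r) = \<sigma>"
  proof -
    have "\<tau> \<circ> (cyc n ^^ r) = \<sigma> \<circ> (cyc n ^^ (i - 1 + (n - (i - 1))))"
      unfolding \<tau>_def r_def cyc_funpow_mod[OF n] by (simp add: comp_assoc funpow_add)
    also have "i - 1 + (n - (i - 1)) = n" using i by auto
    also have "cyc n ^^ n = id" using cyc_funpow_mod[OF n, of n] by simp
    finally show ?thesis by (simp only: comp_id)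
  qed
  moreover have "r < n" using n by (simp add: r_def)
  ultimately show "\<exists>r<n. \<exists>\<tau>. \<tau> permutes {1..n} \<and> \<tau> 1 = 1 \<and> \<sigma> = \<tau> \<circ> (cyc n ^^ r)"
    by metis
next
  fix r s
  assume "r < n \<and> (\<exists>\<tau>. \<tau> permutes {1..n} \<and> \<tau> 1 = 1 \<and> \<sigma> = \<tau> \<circ> (cyc n ^^ r))"
    and "s < n \<and> (\<exists>\<tau>. \<tau> permutes {1..n} \<and> \<tau> 1 = 1 \<and> \<sigma> = \<tau> \<circ> (cyc n ^^ s))"
  thus "r = s" using phase_unique[OF n] by blast
qed

lemma orbital_phase_comp_cyc:
  assumes n: "n \<ge> 1" and \<tau>: "\<tau> permutes {1..n}" "\<tau> 1 = 1"
  shows "orbital_phase n (\<tau> \<circ> (cyc n ^^ r)) = r mod n"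
proof -
  have "(\<tau> \<circ> (cyc n ^^ r)) permutes {1..n}"
    by (intro permutes_compose[OF cyc_funpow_permutes[OF n] \<tau>(1)])
  moreover have "r mod n < n" using n by simp
  moreover have "\<tau> \<circ> (cyc n ^^ r) = \<tau> \<circ> (cyc n ^^ (r mod n))"
    by (simp add: cyc_funpow_mod[OF n])
  ultimately show ?thesis unfolding orbital_phase_def
    using \<tau> by (intro the1_equality orbital_phase_ex1[OF n]) blast+
qed

end

theory Submission
  imports Defs "HOL-Analysis.Complex_Transcendental"
begin

text \<open>
  The transform taking the phase sums \<open>\<Lambda>\<^sub>r\<close> to the numbers \<open>G\<^sub>k\<close> is the discrete Fourier
  transform, which multiplies the squared Euclidean norm by \<open>n\<close> (\<open>parseval_dft\<close>). Hence
  \<open>\<parallel>D\<^sub>\<phi>(A)\<parallel>\<^sup>2 = n \<Sum>\<^sub>r |\<Lambda>\<^sub>r|\<^sup>2\<close>.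

  A permutation with phase \<open>r\<close> is \<open>\<tau> \<circ> \<rho>\<^sup>r\<close> with \<open>\<tau>\<close> fixing \<open>1\<close>, so \<open>\<Lambda>\<^sub>r\<close> has at most
  \<open>(n - 1)!\<close> terms (\<open>card_phase_fibre_le\<close>) and the Cauchy-Schwarz inequality gives
  \<open>|\<Lambda>\<^sub>r|\<^sup>2 \<le> (n - 1)! \<Sum> |m\<^sub>\<sigma>|\<^sup>2\<close>, the sum being over the \<open>\<sigma>\<close> with phase \<open>r\<close>. The
  phases partition \<open>S\<^sub>n\<close>, so the total is at most \<open>n! \<Sum>\<^sub>\<sigma> |m\<^sub>\<sigma>|\<^sup>2\<close>. Signs have disappeared:
  the last sum is the permanent of the nonnegative matrix \<open>(|a\<^sub>i\<^sub>j|\<^sup>2)\<close>, and a permanent with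
  nonnegative entries is at most the product of the column sums (\<open>permanent_le_prod_column_sums\<close>),
  here \<open>\<Prod>\<^sub>j \<parallel>c\<^sub>j\<parallel>\<^sup>2\<close>.
\<close>

text \<open>
  Expanding the product of the column sums gives one term for each choice of a row in every column;
  the bijective choices are the terms of the permanent, and the other terms are nonnegative.
\<close>

lemma permanent_le_prod_column_sums:
  fixes b :: "'a \<Rightarrow> 'a \<Rightarrow> real"
  assumes fin: "finite S" and nonneg: "\<And>i j. i \<in> S \<Longrightarrow> j \<in> S \<Longrightarrow> 0 \<le> b i j"
  shows "(\<Sum>\<sigma> | \<sigma> permutes S. \<Prod>i\<in>S. b i (\<sigma> i)) \<le> (\<Prod>j\<in>S. \<Sum>i\<in>S. b i j)"
proof -
  let ?P = "{\<sigma>. \<sigma> permutes S}"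
  let ?F = "\<lambda>g. \<Prod>j\<in>S. b (g j) j"
  \<comment> \<open>Extensional functions on \<open>S\<close> are undefined outside it, permutations of \<open>S\<close> the identity there.\<close>
  have inj: "inj_on (\<lambda>\<sigma>. restrict \<sigma> S) ?P"
  proof (rule inj_onI, rule ext)
    fix \<sigma> \<tau> x
    assume "\<sigma> \<in> ?P" "\<tau> \<in> ?P" "restrict \<sigma> S = restrict \<tau> S"
    thus "\<sigma> x = \<tau> x"
      by (cases "x \<in> S") (metis restrict_apply', simp add: permutes_not_in)
  qed
  \<comment> \<open>Inverting \<open>\<sigma>\<close> turns the choice of a column in every row into that of a row in every column.\<close>
  have "(\<Sum>\<sigma>\<in>?P. \<Prod>i\<in>S. b i (\<sigma> i)) = (\<Sum>\<sigma>\<in>?P. \<Prod>i\<in>S. b i (inv_into UNIV \<sigma> i))"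
    by (rule sum_permutations_inverse)
  also have "\<dots> = (\<Sum>\<sigma>\<in>?P. ?F \<sigma>)"
  proof (rule sum.cong)
    fix \<sigma> assume "\<sigma> \<in> ?P"
    hence \<sigma>: "\<sigma> permutes S" by simp
    have "(\<Prod>i\<in>S. b i (inv_into UNIV \<sigma> i)) = (\<Prod>j\<in>S. b (\<sigma> j) (inv_into UNIV \<sigma> (\<sigma> j)))"
      using prod.permute[OF \<sigma>, of "\<lambda>i. b i (inv_into UNIV \<sigma> i)"] by (simp add: o_def)
    thus "(\<Prod>i\<in>S. b i (inv_into UNIV \<sigma> i)) = ?F \<sigma>"
      using permutes_inverses(2)[OF \<sigma>] by simp
  qed simp
  also have "\<dots> = (\<Sum>g\<in>(\<lambda>\<sigma>. restrict \<sigma> S) ` ?P. ?F g)"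
    by (simp add: sum.reindex[OF inj])
  also have "\<dots> \<le> (\<Sum>g\<in>PiE S (\<lambda>_. S). ?F g)"
  proof (rule sum_mono2)
    show "finite (PiE S (\<lambda>_. S))" using fin by (intro finite_PiE)
    show "(\<lambda>\<sigma>. restrict \<sigma> S) ` ?P \<subseteq> PiE S (\<lambda>_. S)"
      by (auto simp: permutes_in_image)
    show "0 \<le> ?F g" if "g \<in> PiE S (\<lambda>_. S) - (\<lambda>\<sigma>. restrict \<sigma> S) ` ?P" for g
      using that by (intro prod_nonneg nonneg) (auto simp: PiE_mem)
  qed
  also have "\<dots> = (\<Prod>j\<in>S. \<Sum>i\<in>S. b i j)"
    by (rule prod_sum_PiE[symmetric]) (use fin in auto)
  finally show ?thesis .
qed

lemma norm_sum_squared_le: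
  fixes f :: "'a \<Rightarrow> 'b::real_normed_vector"
  shows "(norm (\<Sum>i\<in>I. f i))\<^sup>2 \<le> card I * (\<Sum>i\<in>I. (norm (f i))\<^sup>2)"
proof -
  have "(norm (\<Sum>i\<in>I. f i))\<^sup>2 \<le> (\<Sum>i\<in>I. norm (f i))\<^sup>2"
    by (intro power_mono norm_sum) simp
  also have "\<dots> \<le> (\<Sum>i\<in>I. (norm (f i))\<^sup>2) * card I"
    by (rule sum_squared_le_sum_of_squares)
  finally show ?thesis by (simp add: mult.commute)
qed

lemma root_unity_power: "root_unity n ^ j = exp (2 * of_real pi * \<i> * of_nat j / of_nat n)"
  by (simp add: root_unity_def exp_of_nat_mult[symmetric] mult_ac)

lemma root_unity_mult_cnj: "root_unity n * cnj (root_unity n) = 1"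
  by (simp add: root_unity_def complex_norm_square[symmetric] norm_exp_eq_Re)

text \<open>
  The summands are the powers of the \<open>n\<close>-th root of unity \<open>\<omega>\<^sup>r * cnj (\<omega>\<^sup>s)\<close>, which differs
  from \<open>1\<close> when \<open>r \<noteq> s\<close>; the geometric sum of its powers is then \<open>0\<close>.
\<close>

lemma root_unity_orthogonality:
  assumes "r < n" "s < n"
  shows "(\<Sum>k<n. root_unity n ^ (k * r) * cnj (root_unity n ^ (k * s))) = (if r = s then of_nat n else 0)"
proof -
  let ?w = "root_unity n"
  define z where "z = ?w ^ r * cnj (?w ^ s)"
  have pow: "?w ^ (k * r) * cnj (?w ^ (k * s)) = z ^ k" for k
    by (simp add: z_def power_mult_distrib power_mult[symmetric] mult.commute)
  have unit: "?w ^ j * cnj (?w ^ j) = 1" for j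
    using root_unity_mult_cnj[of n] by (simp add: power_mult_distrib[symmetric])
  show ?thesis
  proof (cases "r = s")
    case True
    hence "z = 1" using unit by (simp add: z_def)
    thus ?thesis unfolding pow using True by simp
  next
    case False
    have "?w ^ r \<noteq> ?w ^ s"
      using complex_root_unity_eq[of n r s] assms False by (simp add: root_unity_power)
    moreover have "z * ?w ^ s = ?w ^ r"
      using unit[of s] by (simp add: z_def mult_ac)
    ultimately have "z \<noteq> 1" by auto
    moreover have "?w ^ n = 1"
      using complex_root_unity[of n 1] assms by (simp add: root_unity_def)
    hence "z ^ n = 1"
      by (simp add: z_def power_mult_distrib power_commutes flip: power_mult complex_cnj_power)
        (simp add: power_mult mult.commute[of _ n])
    ultimately show ?thesis unfolding pow using False by (simp add: geometric_sum)
  qed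
qed

lemma parseval_dft:
  "(\<Sum>k<n. (cmod (\<Sum>r<n. x r * root_unity n ^ (k * r)))\<^sup>2) = n * (\<Sum>r<n. (cmod (x r))\<^sup>2)"
proof -
  let ?w = "\<lambda>k r. root_unity n ^ (k * r)"
  have "complex_of_real (\<Sum>k<n. (cmod (\<Sum>r<n. x r * ?w k r))\<^sup>2)
      = (\<Sum>k<n. \<Sum>r<n. \<Sum>s<n. x r * cnj (x s) * (?w k r * cnj (?w k s)))"
    by (simp only: of_real_sum complex_norm_square cnj_sum sum_product complex_cnj_mult mult_ac)
  also have "\<dots> = (\<Sum>r<n. \<Sum>k<n. \<Sum>s<n. x r * cnj (x s) * (?w k r * cnj (?w k s)))"
    by (rule sum.swap)
  also have "\<dots> = (\<Sum>r<n. \<Sum>s<n. \<Sum>k<n. x r * cnj (x s) * (?w k r * cnj (?w k s)))"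
    by (intro sum.cong sum.swap refl)
  also have "\<dots> = (\<Sum>r<n. \<Sum>s<n. x r * cnj (x s) * (if r = s then of_nat n else 0))"
    by (intro sum.cong refl) (simp add: root_unity_orthogonality del: complex_cnj_power flip: sum_distrib_left)
  also have "\<dots> = (\<Sum>r<n. x r * cnj (x r) * of_nat n)"
    by (intro sum.cong refl) (simp add: if_distrib[of "\<lambda>y. _ * y"] cong: if_cong)
  also have "\<dots> = complex_of_real (n * (\<Sum>r<n. (cmod (x r))\<^sup>2))"
    by (simp add: complex_norm_square sum_distrib_left mult.commute del: complex_mult_cnj of_real_power)
  finally show ?thesis by (simp only: of_real_eq_iff)
qed

lemma orbital_phase_decomposition:
  assumes "n \<ge> 1" "\<sigma> permutes {1..n}"
  shows "orbital_phase n \<sigma> < n \<and>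
    (\<exists>\<tau>. \<tau> permutes {1..n} \<and> \<tau> 1 = 1 \<and> \<sigma> = \<tau> \<circ> (cyc n ^^ orbital_phase n \<sigma>))"
  unfolding orbital_phase_def by (rule theI'[OF orbital_phase_ex1[OF assms]])

text \<open>
  The fibre of \<open>r\<close> lies in the translate by \<open>\<rho>\<^sup>r\<close> of the stabiliser of \<open>1\<close>, which is the
  symmetric group on \<open>{2..n}\<close>.
\<close>

lemma card_phase_fibre_le:
  assumes n: "n \<ge> 1"
  shows "card {\<sigma>. \<sigma> permutes {1..n} \<and> orbital_phase n \<sigma> = r} \<le> fact (n - 1)"
proof -
  have fin: "finite {\<tau>. \<tau> permutes {2..n}}" by (rule finite_permutations) simp
  have "{\<sigma>. \<sigma> permutes {1..n} \<and> orbital_phase n \<sigma> = r}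
      \<subseteq> (\<lambda>\<tau>. \<tau> \<circ> (cyc n ^^ r)) ` {\<tau>. \<tau> permutes {2..n}}"
  proof
    fix \<sigma> assume "\<sigma> \<in> {\<sigma>. \<sigma> permutes {1..n} \<and> orbital_phase n \<sigma> = r}"
    then obtain \<tau> where \<tau>: "\<tau> permutes {1..n}" "\<tau> 1 = 1" "\<sigma> = \<tau> \<circ> (cyc n ^^ r)"
      using orbital_phase_decomposition[OF n] by blast
    have "\<tau> x = x" if "x \<in> {1..n} - {2..n}" for x
    proof -
      have "x = 1" using that by auto
      thus ?thesis using \<tau>(2) by simp
    qed
    hence "\<tau> permutes {2..n}" by (rule permutes_superset[OF \<tau>(1)])
    thus "\<sigma> \<in> (\<lambda>\<tau>. \<tau> \<circ> (cyc n ^^ r)) ` {\<tau>. \<tau> permutes {2..n}}" using \<tau>(3) by blast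
  qed
  hence "card {\<sigma>. \<sigma> permutes {1..n} \<and> orbital_phase n \<sigma> = r} \<le> card {\<tau>. \<tau> permutes {2..n}}"
    by (rule surj_card_le[OF fin])
  also have "\<dots> = fact (n - 1)" by (rule card_permutations) simp_all
  finally show ?thesis .
qed

lemma norm_perm_monomial_squared:
  "(cmod (perm_monomial n A \<sigma>))\<^sup>2 = (\<Prod>i = 1..n. (cmod (A $$ (i - 1, \<sigma> i - 1)))\<^sup>2)"
proof -
  have "cmod (of_int (sign \<sigma>)) = 1"
    by (cases \<sigma> rule: sign_cases) simp_all
  thus ?thesis
    by (simp add: perm_monomial_def norm_mult power_mult_distrib prod_norm[symmetric] prod_power_distrib)
qed

lemma sum_norm_perm_monomial_squared_le:
  assumes A: "A \<in> carrier_mat n n"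
  shows "(\<Sum>\<sigma> | \<sigma> permutes {1..n}. (cmod (perm_monomial n A \<sigma>))\<^sup>2)
    \<le> (\<Prod>j = 0..<n. vec_l2_norm (col A j))\<^sup>2"
proof -
  have shift: "bij_betw (\<lambda>i. i - 1) {1..n} {0..<n}"
    by (rule bij_betwI[where g = Suc]) auto
  have "(\<Sum>\<sigma> | \<sigma> permutes {1..n}. (cmod (perm_monomial n A \<sigma>))\<^sup>2)
      \<le> (\<Prod>j = 1..n. \<Sum>i = 1..n. (cmod (A $$ (i - 1, j - 1)))\<^sup>2)"
    unfolding norm_perm_monomial_squared
    by (rule permanent_le_prod_column_sums[where b = "\<lambda>i j. (cmod (A $$ (i - 1, j - 1)))\<^sup>2"]) auto
  also have "\<dots> = (\<Prod>j = 0..<n. \<Sum>i = 1..n. (cmod (A $$ (i - 1, j)))\<^sup>2)"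
    by (rule prod.reindex_bij_betw[OF shift])
  also have "\<dots> = (\<Prod>j = 0..<n. \<Sum>i = 0..<n. (cmod (A $$ (i, j)))\<^sup>2)"
    by (intro prod.cong sum.reindex_bij_betw[OF shift] refl)
  also have "\<dots> = (\<Prod>j = 0..<n. (vec_l2_norm (col A j))\<^sup>2)"
    using A by (intro prod.cong refl) (auto simp: vec_l2_norm_def L2_set_def sum_nonneg)
  finally show ?thesis by (simp add: prod_power_distrib)
qed

theorem theorem9p11:
  fixes n :: nat and A :: "complex mat"
  assumes "n \<ge> 1" and "A \<in> carrier_mat n n"
  shows "vec_l2_norm (D_phase n A) \<le> sqrt (fact n) * (\<Prod>j = 0..<n. vec_l2_norm (col A j))"
proof -
  let ?m = "\<lambda>\<sigma>. (cmod (perm_monomial n A \<sigma>))\<^sup>2"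
  let ?P = "{\<sigma>. \<sigma> permutes {1..n}}"
  let ?R = "\<Prod>j = 0..<n. vec_l2_norm (col A j)"
  have "(vec_l2_norm (D_phase n A))\<^sup>2
      = (\<Sum>k<n. (cmod (\<Sum>r<n. phase_sum n A r * root_unity n ^ (k * r)))\<^sup>2)"
    by (simp add: vec_l2_norm_def D_phase_def phase_transform_def L2_set_def sum_nonneg
        atLeast0LessThan)
  also have "\<dots> = n * (\<Sum>r<n. (cmod (phase_sum n A r))\<^sup>2)"
    by (rule parseval_dft)
  also have "\<dots> \<le> n * (\<Sum>r<n. fact (n - 1) * (\<Sum>\<sigma> | \<sigma> \<in> ?P \<and> orbital_phase n \<sigma> = r. ?m \<sigma>))"
  proof (intro mult_left_mono sum_mono)
    fix r
    let ?fibre = "{\<sigma>. \<sigma> permutes {1..n} \<and> orbital_phase n \<sigma> = r}"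
    have "(cmod (phase_sum n A r))\<^sup>2 \<le> card ?fibre * (\<Sum>\<sigma>\<in>?fibre. ?m \<sigma>)"
      unfolding phase_sum_def by (rule norm_sum_squared_le)
    also have "\<dots> \<le> real (fact (n - 1)) * (\<Sum>\<sigma>\<in>?fibre. ?m \<sigma>)"
      using card_phase_fibre_le[OF assms(1), of r]
      by (intro mult_right_mono sum_nonneg) (simp_all only: of_nat_le_iff zero_le_power2)
    finally show "(cmod (phase_sum n A r))\<^sup>2
        \<le> fact (n - 1) * (\<Sum>\<sigma> | \<sigma> \<in> ?P \<and> orbital_phase n \<sigma> = r. ?m \<sigma>)"
      by simp
  qed simp
  also have "\<dots> = fact n * (\<Sum>r<n. \<Sum>\<sigma> | \<sigma> \<in> ?P \<and> orbital_phase n \<sigma> = r. ?m \<sigma>)"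
    using assms(1) by (simp add: fact_reduce[of n] flip: sum_distrib_left)
  also have "(\<Sum>r<n. \<Sum>\<sigma> | \<sigma> \<in> ?P \<and> orbital_phase n \<sigma> = r. ?m \<sigma>) = (\<Sum>\<sigma>\<in>?P. ?m \<sigma>)"
    using orbital_phase_decomposition[OF assms(1)]
    by (intro sum.group finite_permutations) auto
  also have "fact n * \<dots> \<le> fact n * ?R\<^sup>2"
    by (intro mult_left_mono sum_norm_perm_monomial_squared_le[OF assms(2)]) simp
  also have "\<dots> = (sqrt (fact n) * ?R)\<^sup>2"
    by (simp add: power_mult_distrib)
  finally show ?thesis
    by (rule power2_le_imp_le)
      (intro mult_nonneg_nonneg prod_nonneg, simp_all add: vec_l2_norm_def)
qed

end
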